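(* Let $K$ be a field, $R=K[x,y]$, $\mathfrak m=(x,y)$, and let $n\ge 2$. Let $I\subset R$ be an ideal minimally generated by $n$ monomials listed lexicographically, $$I=(x^{a_1},\, x^{a_2}y^{b_{n-1}},\ldots,x^{a_i}y^{b_{n-i+1}},\ldots, x^{a_{n-1}}y^{b_2},\, y^{b_1}),$$ where $a_1>a_2>\cdots>a_{n-1}>a_n:=0$ and $b_1>b_2>\cdots>b_{n-1}>b_n:=0$ are integers. Then $I$ is $\mathfrak m$-full if and only if there is an integer $k$ with $1\le k\le n$ such that the following conditions hold: (1) $b_{n-i}-b_{n-i+1}=1$ for $1\le i\le k-1$; (2) $k=n$, or $k<n$ and $b_{n-k}-b_{n-k+1}\ge 2$; (3) $a_i-a_{i+1}=1$ for $k\le i\le n-1$.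
   Context: An $\mathfrak m$-primary ideal $L$ of $R$ is called $\mathfrak m$-full if $\mathfrak m L:a=L$ for some $a\in\mathfrak m\setminus\mathfrak m^2$. *)

theory Defs
  imports "HOL-Algebra.Algebraic_Closure_Type" "HOL-Algebra.Ideal_Product"
    "HOL-Computational_Algebra.Polynomial"
begin

locale primary_ideal = ideal I R + cring R for I and R (structure) +
  assumes I_notcarr: "carrier R \<noteq> I"
    and I_primary: "\<lbrakk>a \<in> carrier R; b \<in> carrier R; a \<otimes> b \<in> I\<rbrakk> \<Longrightarrow> a \<in> I \<or> (\<exists>n::nat. b [^] n \<in> I)"

definition ideal_radical :: "('a, 'b) ring_scheme \<Rightarrow> 'a set \<Rightarrow> 'a set" where
  "ideal_radical R I = {r \<in> carrier R. \<exists>n::nat. r [^]\<^bsub>R\<^esub> n \<in> I}"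

definition ideal_colon :: "('a, 'b) ring_scheme \<Rightarrow> 'a set \<Rightarrow> 'a \<Rightarrow> 'a set" where
  "ideal_colon R I a = {r \<in> carrier R. r \<otimes>\<^bsub>R\<^esub> a \<in> I}"

text \<open>
  Being \<open>M\<close>-full only makes sense for \<open>M\<close>-primary ideals, so being \<open>M\<close>-primary is a conjunct.
\<close>
definition m_full :: "('a, 'b) ring_scheme \<Rightarrow> 'a set \<Rightarrow> 'a set \<Rightarrow> bool" where
  "m_full R M L \<longleftrightarrow> primary_ideal L R \<and> ideal_radical R L = M \<and>
     (\<exists>a \<in> M - M \<cdot>\<^bsub>R\<^esub> M. ideal_colon R (M \<cdot>\<^bsub>R\<^esub> L) a = L)"

text \<open>
  \<open>K[x,y]\<close> is represented as \<open>K[x][y]\<close>: the outer polynomial variable is \<open>y\<close>, and \<open>x\<close> is the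
  variable of the coefficient ring.
\<close>
definition Kxy :: "'k::field poly poly ring" where
  "Kxy = ring_of_type_algebra"

definition var_x :: "'k::field poly poly" where
  "var_x = [:[:0, 1:]:]"

definition var_y :: "'k::field poly poly" where
  "var_y = [:0, 1:]"

definition ideal_xy :: "'k::field poly poly set" where
  "ideal_xy = Idl\<^bsub>Kxy\<^esub> {var_x, var_y}"

end

theory Submission
  imports Defs
begin

text \<open>
  Write \<open>\<mm> = (x, y)\<close> and let \<open>G\<close> be the set of exponents \<open>(a i, c i)\<close> of the generators of \<open>I\<close>,
  where \<open>c i = b (n - i + 1)\<close>.  Both sides of the equivalence say that some generator has degree
  less than \<open>n\<close>, that is, that the order of \<open>I\<close> is as small as the number of generators allows.

  Fullness forces such a generator (lemma \<open>full_imp_small_generator\<close>).  Suppose that all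
  generators have degree at least \<open>n\<close>, and let \<open>f\<close> be any element of \<open>\<mm>\<close>.  Look for a
  polynomial \<open>g\<close> whose monomials have degree at least \<open>n\<close>, lie outside \<open>\<mm>I\<close> and are no
  generators, such that \<open>f * g\<close> lies in \<open>\<mm>I\<close>.  This is a homogeneous linear system: the equations
  are indexed by the monomials outside \<open>\<mm>I\<close> of degree more than \<open>n\<close>; there are \<open>n + 1\<close> more
  candidates for the monomials of \<open>g\<close>, namely those of degree exactly \<open>n\<close>, and at most \<open>n\<close> are
  excluded as generators.  Unknowns outnumber equations, so there is a nonzero \<open>g\<close>.  It is in
  \<open>\<mm>I : f\<close> but not in \<open>I\<close>.

  Conversely, strict monotonicity gives \<open>n - i \<le> a i\<close> and \<open>i - 1 \<le> c i\<close>.  A generator of degree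
  less than \<open>n\<close> attains both bounds, and then all steps of \<open>c\<close> before it and all steps of \<open>a\<close>
  after it are 1 (lemma \<open>small_generator_iff_unit_steps\<close>).  For such a staircase \<open>x + y\<close>
  witnesses fullness (lemma \<open>colon_x_plus_y\<close>): the conditions on the coefficients of \<open>f\<close> imposed by
  \<open>f * (x + y) \<in> \<mm>I\<close> form recursions along antidiagonals that start at an axis, and unit steps keep
  these recursions outside \<open>I\<close>.
\<close>

section \<open>Coefficients in two variables\<close>

text \<open>
  The first index is the exponent of \<open>x\<close>, although \<open>x\<close> is the inner variable.
\<close>
definition cf :: "'k::field poly poly \<Rightarrow> nat \<Rightarrow> nat \<Rightarrow> 'k" where
  "cf f i j = Polynomial.coeff (Polynomial.coeff f j) i"

definition cmonom :: "'k::field \<Rightarrow> nat \<Rightarrow> nat \<Rightarrow> 'k poly poly" where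
  "cmonom c i j = Polynomial.monom (Polynomial.monom c i) j"

lemma cf_eqI: "(\<And>i j. cf f i j = cf g i j) \<Longrightarrow> f = g"
  unfolding cf_def by (intro poly_eqI) auto

lemma cf_simps [simp]:
  "cf 0 i j = 0" "cf (f + g) i j = cf f i j + cf g i j"
  "cf (- f) i j = - cf f i j" "cf (f - g) i j = cf f i j - cf g i j"
  by (simp_all add: cf_def)

lemma cf_one: "cf 1 i j = (if i = 0 \<and> j = 0 then 1 else 0)"
  by (auto simp: cf_def coeff_1)

lemma cf_sum: "cf (\<Sum>p\<in>A. F p) i j = (\<Sum>p\<in>A. cf (F p) i j)"
  by (simp add: cf_def coeff_sum)

lemma cf_mult: "cf (f * g) i j = (\<Sum>l\<le>j. \<Sum>k\<le>i. cf f k l * cf g (i - k) (j - l))"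
  by (simp add: cf_def Polynomial.coeff_mult coeff_sum)

lemma cf_cmonom: "cf (cmonom c k l) i j = (if k = i \<and> l = j then c else 0)"
  by (simp add: cf_def cmonom_def)

lemma cf_cmonom_mult:
  "cf (cmonom c k l * f) i j = (if k \<le> i \<and> l \<le> j then c * cf f (i - k) (j - l) else 0)"
  by (auto simp: cf_def cmonom_def coeff_monom_mult)

lemma cmonom_mult: "cmonom c i j * cmonom d k l = cmonom (c * d) (i + k) (j + l)"
  by (simp add: cmonom_def mult_monom)

lemma var_x_cmonom: "var_x = cmonom 1 1 0"
  by (simp add: var_x_def cmonom_def Polynomial.monom_0 Polynomial.monom_Suc one_pCons)

lemma var_y_cmonom: "var_y = cmonom 1 0 1"
  by (simp add: var_y_def cmonom_def Polynomial.monom_0 Polynomial.monom_Suc one_pCons)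

lemma var_power_cmonom: "var_x ^ i * var_y ^ j = cmonom 1 i j"
  by (simp add: var_x_cmonom var_y_cmonom cmonom_def monom_power mult_monom)

lemma sum_of_cmonoms:
  fixes f :: "'k::field poly poly"
  shows "f = (\<Sum>j\<le>degree f. \<Sum>i\<le>degree (Polynomial.coeff f j). cmonom (cf f i j) i j)"
proof -
  have "(\<Sum>i\<le>degree (Polynomial.coeff f j). cmonom (cf f i j) i j)
      = Polynomial.monom (Polynomial.coeff f j) j" for j
  proof -
    have "(\<Sum>i\<le>degree (Polynomial.coeff f j). cmonom (cf f i j) i j)
      = Polynomial.monom (\<Sum>i\<le>degree (Polynomial.coeff f j).
          Polynomial.monom (Polynomial.coeff (Polynomial.coeff f j) i) i) j"
      unfolding cmonom_def cf_def
      by (rule poly_eqI) (simp add: coeff_sum)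
    then show ?thesis by (simp add: poly_as_sum_of_monoms)
  qed
  then show ?thesis by (simp add: poly_as_sum_of_monoms)
qed

text \<open>
  An additively closed set contains \<open>f\<close> as soon as it contains the terms that occur in \<open>f\<close>; this
  is how membership in an ideal given by generators is reduced to monomials.
\<close>
lemma cmonom_induct:
  fixes f :: "'k::field poly poly"
  assumes zero: "0 \<in> P" and add: "\<And>g h. g \<in> P \<Longrightarrow> h \<in> P \<Longrightarrow> g + h \<in> P"
    and monoms: "\<And>i j. cf f i j \<noteq> 0 \<Longrightarrow> cmonom (cf f i j) i j \<in> P"
  shows "f \<in> P"
proof -
  have sum_in: "(\<Sum>a\<in>A. F a) \<in> P" if "finite A" "\<And>a. a \<in> A \<Longrightarrow> F a \<in> P"
    for A :: "nat set" and F
    using that by (induction A rule: finite_induct) (auto intro: zero add)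
  have "cmonom (cf f i j) i j \<in> P" for i j
    using monoms[of i j] zero by (cases "cf f i j = 0") (auto simp: cmonom_def)
  then show ?thesis
    by (subst sum_of_cmonoms) (intro sum_in, auto)
qed

section \<open>Monomial ideals\<close>

definition mono_ideal :: "(nat \<times> nat) set \<Rightarrow> 'k::field poly poly set" where
  "mono_ideal S = {f. \<forall>i j. cf f i j \<noteq> 0 \<longrightarrow> (i, j) \<in> S}"

definition upset :: "(nat \<times> nat) set \<Rightarrow> (nat \<times> nat) set" where
  "upset G = {(i, j). \<exists>(k, l)\<in>G. k \<le> i \<and> l \<le> j}"

definition exp_sum :: "(nat \<times> nat) set \<Rightarrow> (nat \<times> nat) set \<Rightarrow> (nat \<times> nat) set" where
  "exp_sum S T = {(i + k, j + l) | i j k l. (i, j) \<in> S \<and> (k, l) \<in> T}"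

lemma mono_idealD: "f \<in> mono_ideal S \<Longrightarrow> (i, j) \<notin> S \<Longrightarrow> cf f i j = 0"
  by (auto simp: mono_ideal_def)

text \<open>
  A nonzero coefficient of \<open>f * g\<close> needs a nonzero product of coefficients in the convolution sum.
\<close>
lemma mono_ideal_mult:
  assumes f: "f \<in> mono_ideal S" and g: "g \<in> mono_ideal T"
  shows "f * g \<in> mono_ideal (exp_sum S T)"
proof -
  have "cf (f * g) i j = 0" if "(i, j) \<notin> exp_sum S T" for i j
  proof -
    have "cf f k l * cf g (i - k) (j - l) = 0" if kl: "k \<le> i" "l \<le> j" for k l
    proof (rule ccontr)
      assume "\<not> ?thesis"
      then have "(k, l) \<in> S" "(i - k, j - l) \<in> T"
        using mono_idealD[OF f] mono_idealD[OF g] by auto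
      then have "(k + (i - k), l + (j - l)) \<in> exp_sum S T"
        unfolding exp_sum_def by blast
      with kl \<open>(i, j) \<notin> exp_sum S T\<close> show False by simp
    qed
    then show ?thesis unfolding cf_mult by (intro sum.neutral ballI) auto
  qed
  then show ?thesis by (auto simp: mono_ideal_def)
qed

lemma Kxy_simps [simp]:
  "carrier Kxy = UNIV" "f \<otimes>\<^bsub>Kxy\<^esub> g = f * g" "f \<oplus>\<^bsub>Kxy\<^esub> g = f + g"
  "\<one>\<^bsub>Kxy\<^esub> = 1" "\<zero>\<^bsub>Kxy\<^esub> = 0"
  by (simp_all add: Kxy_def ring_of_type_algebra_def)

lemma cring_Kxy: "cring Kxy"
  unfolding Kxy_def by (rule cring_from_type_algebra)

lemma ring_Kxy: "ring Kxy"
  using cring_Kxy by (rule cring.axioms)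

lemma pow_Kxy [simp]: "f [^]\<^bsub>Kxy\<^esub> (n::nat) = f ^ n"
proof -
  interpret cring Kxy by (rule cring_Kxy)
  show ?thesis by (induction n) (simp_all add: nat_pow_Suc mult.commute)
qed

lemma ideal_KxyI:
  assumes J0: "0 \<in> J" and Jadd: "\<And>f g. f \<in> J \<Longrightarrow> g \<in> J \<Longrightarrow> f + g \<in> J"
    and Jmult: "\<And>f g. f \<in> J \<Longrightarrow> g * f \<in> J"
  shows "ideal J Kxy"
proof (rule idealI[OF ring_Kxy])
  interpret cring Kxy by (rule cring_Kxy)
  show "subgroup J (add_monoid Kxy)"
  proof (rule add.subgroupI)
    fix f assume f: "f \<in> J"
    have "\<ominus>\<^bsub>Kxy\<^esub> f = - f"
      by (rule minus_equality) auto
    moreover have "- f \<in> J" using Jmult[OF f, of "-1"] by simp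
    ultimately show "\<ominus>\<^bsub>Kxy\<^esub> f \<in> J" by simp
  qed (use J0 Jadd in auto)
qed (use Jmult in \<open>auto simp: mult.commute\<close>)

lemma ideal_KxyD:
  assumes "ideal J Kxy"
  shows "0 \<in> J" "f \<in> J \<Longrightarrow> g \<in> J \<Longrightarrow> f + g \<in> J" "f \<in> J \<Longrightarrow> g * f \<in> J"
proof -
  interpret ideal J Kxy by (rule assms)
  show "0 \<in> J" using additive_subgroup.zero_closed[OF is_additive_subgroup] by simp
  show "f \<in> J \<Longrightarrow> g \<in> J \<Longrightarrow> f + g \<in> J" 
    using additive_subgroup.a_closed[OF is_additive_subgroup, of f g] by simp
  show "f \<in> J \<Longrightarrow> g * f \<in> J" using I_l_closed[of f g] by simp
qed

lemma upset_mono: "(i, j) \<in> upset G \<Longrightarrow> i \<le> i' \<Longrightarrow> j \<le> j' \<Longrightarrow> (i', j') \<in> upset G"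
  unfolding upset_def by (auto intro: order_trans)

lemma ideal_mono_ideal: "ideal (mono_ideal (upset G)) Kxy"
proof (rule ideal_KxyI)
  fix f g assume f: "f \<in> mono_ideal (upset G)"
  show "f + g \<in> mono_ideal (upset G)" if "g \<in> mono_ideal (upset G)"
    using mono_idealD[OF f] mono_idealD[OF that] unfolding mono_ideal_def by fastforce
  have "g \<in> mono_ideal UNIV" by (simp add: mono_ideal_def)
  from mono_ideal_mult[OF this f] show "g * f \<in> mono_ideal (upset G)"
    by (fastforce simp: mono_ideal_def exp_sum_def intro: upset_mono)
qed (simp add: mono_ideal_def)

text \<open>
  Membership in a monomial ideal is decided term by term, so questions about such ideals become
  questions about sets of exponents.
\<close>
lemma genideal_monomials:
  "Idl\<^bsub>Kxy\<^esub> {var_x ^ i * var_y ^ j | i j. (i, j) \<in> G}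
    = (mono_ideal (upset G) :: 'k::field poly poly set)"
    (is "Idl\<^bsub>Kxy\<^esub> ?X = _")
proof
  interpret cring Kxy by (rule cring_Kxy)
  show "Idl\<^bsub>Kxy\<^esub> ?X \<subseteq> mono_ideal (upset G)"
    by (rule genideal_minimal[OF ideal_mono_ideal])
      (auto simp: var_power_cmonom mono_ideal_def cf_cmonom upset_def split: if_splits)
  have idl: "ideal (Idl\<^bsub>Kxy\<^esub> ?X) Kxy" by (rule genideal_ideal) simp
  show "mono_ideal (upset G) \<subseteq> Idl\<^bsub>Kxy\<^esub> ?X"
  proof
    fix f :: "'k poly poly" assume f: "f \<in> mono_ideal (upset G)"
    show "f \<in> Idl\<^bsub>Kxy\<^esub> ?X"
    proof (rule cmonom_induct)
      fix i j assume "cf f i j \<noteq> 0"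
      with f have "(i, j) \<in> upset G" by (auto simp: mono_ideal_def)
      then obtain k l where kl: "(k, l) \<in> G" "k \<le> i" "l \<le> j"
        by (auto simp: upset_def)
      have "var_x ^ k * var_y ^ l \<in> ?X" using kl(1) by blast
      moreover have "?X \<subseteq> Idl\<^bsub>Kxy\<^esub> ?X" by (rule genideal_self) simp
      ultimately have "cmonom 1 k l \<in> Idl\<^bsub>Kxy\<^esub> ?X"
        unfolding var_power_cmonom[symmetric] by blast
      from ideal_KxyD(3)[OF idl this, of "cmonom (cf f i j) (i - k) (j - l)"]
      show "cmonom (cf f i j) i j \<in> Idl\<^bsub>Kxy\<^esub> ?X"
        using kl by (simp add: cmonom_mult)
    qed (use ideal_KxyD[OF idl] in auto)
  qed
qed

lemma ideal_prod_mono_ideal: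
  "mono_ideal (upset G) \<cdot>\<^bsub>Kxy\<^esub> mono_ideal (upset H)
    = (mono_ideal (exp_sum (upset G) (upset H)) :: 'k::field poly poly set)"
    (is "?P = ?M")
proof
  show "?P \<subseteq> ?M"
  proof
    fix f assume "f \<in> ?P"
    then show "f \<in> ?M"
    proof induction
      case (prod i j)
      then show ?case by (simp add: mono_ideal_mult)
    next
      case (sum f g)
      have "cf f i j = 0 \<and> cf g i j = 0" if "(i, j) \<notin> exp_sum (upset G) (upset H)" for i j
        using sum.IH that by (auto dest: mono_idealD)
      then show ?case by (fastforce simp: mono_ideal_def)
    qed
  qed
  interpret cring Kxy by (rule cring_Kxy)
  have idl: "ideal ?P Kxy"
    by (intro ideal_prod_is_ideal ideal_mono_ideal)
  show "?M \<subseteq> ?P"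
  proof
    fix f :: "'k poly poly" assume f: "f \<in> ?M"
    show "f \<in> ?P"
    proof (rule cmonom_induct)
      fix i j assume "cf f i j \<noteq> 0"
      with f have "(i, j) \<in> exp_sum (upset G) (upset H)" by (auto simp: mono_ideal_def)
      then obtain p q r s where e: "i = p + r" "j = q + s" "(p, q) \<in> upset G" "(r, s) \<in> upset H"
        by (auto simp: exp_sum_def)
      have "cmonom (cf f i j) p q * cmonom 1 r s \<in> ?P"
        using e(3,4) ideal_prod.prod[of "cmonom (cf f i j) p q" _ "cmonom 1 r s" _ Kxy]
        by (simp add: mono_ideal_def cf_cmonom)
      then show "cmonom (cf f i j) i j \<in> ?P"
        by (simp add: cmonom_mult e(1,2))
    qed (use ideal_KxyD[OF idl] in auto)
  qed
qed

definition max_exps :: "(nat \<times> nat) set" where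
  "max_exps = {(1, 0), (0, 1)}"

lemma upset_max_exps: "upset max_exps = {(i, j). 0 < i + j}"
  by (auto simp: upset_def max_exps_def)

lemma ideal_xy_mono_ideal: "ideal_xy = (mono_ideal (upset max_exps) :: 'k::field poly poly set)"
proof -
  have "{var_x ^ i * var_y ^ j :: 'k poly poly | i j. (i, j) \<in> max_exps}
      = (\<lambda>(i, j). var_x ^ i * var_y ^ j) ` max_exps"
    by auto
  also have "\<dots> = {var_x, var_y}" by (simp add: max_exps_def)
  finally have "{var_x, var_y} = {var_x ^ i * var_y ^ j :: 'k poly poly | i j. (i, j) \<in> max_exps}"
    ..
  then show ?thesis
    by (simp add: ideal_xy_def genideal_monomials)
qed

text \<open>
  The monomials in \<open>\<mm>I\<close> are the proper multiples of generators of \<open>I\<close>.  In particular a monomial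
  in \<open>I\<close> outside \<open>\<mm>I\<close> is itself one of the given generators.
\<close>
lemma exp_sum_max_iff:
  "(i, j) \<in> exp_sum (upset max_exps) (upset G)
    \<longleftrightarrow> (\<exists>(k, l)\<in>G. k \<le> i \<and> l \<le> j \<and> (k, l) \<noteq> (i, j))"
proof
  assume "(i, j) \<in> exp_sum (upset max_exps) (upset G)"
  then obtain p q r s k l where "i = p + r" "j = q + s" "0 < p + q"
      "(k, l) \<in> G" "k \<le> r" "l \<le> s"
    by (auto simp: exp_sum_def upset_max_exps) (auto simp: upset_def)
  then show "\<exists>(k, l)\<in>G. k \<le> i \<and> l \<le> j \<and> (k, l) \<noteq> (i, j)"
    by (intro bexI[of _ "(k, l)"]) auto
next
  assume "\<exists>(k, l)\<in>G. k \<le> i \<and> l \<le> j \<and> (k, l) \<noteq> (i, j)"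
  then obtain k l where kl: "(k, l) \<in> G" "k \<le> i" "l \<le> j" "(k, l) \<noteq> (i, j)" by auto
  then have "(i - k, j - l) \<in> upset max_exps" "(k, l) \<in> upset G"
    unfolding upset_max_exps by (auto simp: upset_def)
  moreover have "(i, j) = (i - k + k, j - l + l)" using kl by simp
  ultimately show "(i, j) \<in> exp_sum (upset max_exps) (upset G)"
    unfolding exp_sum_def by blast
qed

section \<open>Primary monomial ideals\<close>

lemma power_ideal_xy:
  "f \<in> ideal_xy \<Longrightarrow> f ^ n \<in> mono_ideal {(i, j). n \<le> i + j}"
proof (induction n)
  case (Suc n)
  have "f * f ^ n \<in> mono_ideal (exp_sum (upset max_exps) {(i, j). n \<le> i + j})"
    using Suc by (intro mono_ideal_mult) (simp_all add: ideal_xy_mono_ideal)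
  then show ?case
    by (fastforce simp: mono_ideal_def exp_sum_def upset_max_exps)
qed (simp add: mono_ideal_def)

text \<open>
  Some power of \<open>\<mm>\<close> lies in \<open>L\<close>, because \<open>L\<close> contains a power of each variable.  As \<open>\<mm>\<close> is maximal,
  an element outside \<open>\<mm>\<close> is therefore invertible modulo \<open>L\<close>.
\<close>
lemma mono_ideal_primary:
  fixes G :: "(nat \<times> nat) set"
  defines "L \<equiv> (mono_ideal (upset G) :: 'k::field poly poly set)"
  assumes s: "(s, 0) \<in> G" and t: "(0, t) \<in> G" and proper: "(0, 0) \<notin> G"
  shows "primary_ideal L Kxy" "ideal_radical Kxy L = ideal_xy"
proof -
  have idl: "ideal L Kxy" unfolding L_def by (rule ideal_mono_ideal)
  have origin: "(0, 0) \<notin> upset G" using proper by (auto simp: upset_def)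
  have "(i, j) \<in> upset G" if "s + t \<le> i + j" for i j
  proof (cases "s \<le> i")
    case True
    then show ?thesis using s by (auto simp: upset_def)
  next
    case False
    then have "t \<le> j" using that by simp
    then show ?thesis using t by (auto simp: upset_def)
  qed
  then have nilp: "f ^ (s + t) \<in> L" if "f \<in> ideal_xy" for f
    using power_ideal_xy[OF that, of "s + t"] by (auto simp: L_def mono_ideal_def)
  have in_xy: "f \<in> ideal_xy \<longleftrightarrow> cf f 0 0 = 0" for f :: "'k poly poly"
    by (auto simp: ideal_xy_mono_ideal mono_ideal_def upset_max_exps) (metis gr0I)
  have const: "cf (f ^ n) 0 0 = cf f 0 0 ^ n" for f :: "'k poly poly" and n
    by (induction n) (simp_all add: cf_one cf_mult)
  have L_const: "cf f 0 0 = 0" if "f \<in> L" for f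
    using that origin unfolding L_def by (rule mono_idealD)
  show "ideal_radical Kxy L = ideal_xy"
  proof (intro equalityI subsetI)
    fix f assume "f \<in> ideal_radical Kxy L"
    then obtain n where "f ^ n \<in> L" by (auto simp: ideal_radical_def)
    then have "cf f 0 0 ^ n = 0" using L_const const by metis
    then show "f \<in> ideal_xy" by (simp add: in_xy)
  next
    fix f :: "'k poly poly" assume "f \<in> ideal_xy"
    then show "f \<in> ideal_radical Kxy L" using nilp[of f] by (auto simp: ideal_radical_def)
  qed
  show "primary_ideal L Kxy"
  proof (intro primary_ideal.intro primary_ideal_axioms.intro idl cring_Kxy)
    have "1 \<notin> L" using L_const[of 1] by (auto simp: cf_one)
    then show "carrier Kxy \<noteq> L" by auto
  next
    fix f g assume fg: "f \<otimes>\<^bsub>Kxy\<^esub> g \<in> L"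
    show "f \<in> L \<or> (\<exists>n::nat. g [^]\<^bsub>Kxy\<^esub> n \<in> L)"
    proof (cases "g \<in> ideal_xy")
      case True
      then show ?thesis using nilp[of g] by (auto intro!: exI[of _ "s + t"])
    next
      case False
      \<comment> \<open>\<open>g\<close> has an inverse modulo \<open>\<mm>\<close>; the geometric series in the error \<open>u\<close> lifts it to one modulo \<open>L\<close>.\<close>
      define u where "u = 1 - cmonom (1 / cf g 0 0) 0 0 * g"
      have "u \<in> ideal_xy"
        using False by (simp add: u_def in_xy cf_one cf_cmonom_mult)
      then have uL: "u ^ (s + t) \<in> L" by (rule nilp)
      have "1 - u dvd 1 - u ^ (s + t)"
        unfolding one_diff_power_eq by (rule dvd_triv_left)
      then have "g dvd 1 - u ^ (s + t)"
        unfolding u_def by (simp add: dvd_mult_right)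
      then obtain h where h: "1 - u ^ (s + t) = g * h" by (elim dvdE)
      have "f = f * u ^ (s + t) + h * (f * g)"
        using arg_cong[OF h, of "(*) f"] by (simp add: algebra_simps)
      also have "\<dots> \<in> L" using uL fg by (simp add: ideal_KxyD(2,3)[OF idl])
      finally show ?thesis ..
    qed
  qed
qed

section \<open>The number of generators of a full monomial ideal\<close>

text \<open>
  Gaussian elimination: if some unknown \<open>q\<close> occurs in equation \<open>b\<close>, solve \<open>b\<close> for it and substitute
  into the remaining equations, which removes one unknown and one equation.
\<close>
lemma homogeneous_system_nontrivial:
  fixes c :: "'b \<Rightarrow> 'a \<Rightarrow> 'k::field"
  assumes "finite B" "finite A" "card B < card A"
  shows "\<exists>u. (\<exists>p\<in>A. u p \<noteq> 0) \<and> (\<forall>b\<in>B. (\<Sum>p\<in>A. c b p * u p) = 0)"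
  using assms
proof (induction B arbitrary: A c rule: finite_induct)
  case empty
  then obtain p where "p \<in> A" by fastforce
  then show ?case by (intro exI[of _ "\<lambda>_. 1"]) auto
next
  case (insert b B)
  show ?case
  proof (cases "\<forall>p\<in>A. c b p = 0")
    case True
    have "card B < card A" using insert by simp
    from insert.IH[OF insert.prems(1) this, of c] True show ?thesis by auto
  next
    case False
    then obtain q where q: "q \<in> A" "c b q \<noteq> 0" by auto
    define A' where "A' = A - {q}"
    have A': "finite A'" "q \<notin> A'" "A = insert q A'" using insert.prems q by (auto simp: A'_def)
    have "card B < card A'" using insert A' by simp
    from insert.IH[OF A'(1) this, of "\<lambda>e p. c e p - c e q * c b p / c b q"]
    obtain u where u: "\<exists>p\<in>A'. u p \<noteq> 0"
      "\<And>e. e \<in> B \<Longrightarrow> (\<Sum>p\<in>A'. (c e p - c e q * c b p / c b q) * u p) = 0" by auto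
    define v where "v = u(q := - (\<Sum>p\<in>A'. c b p * u p) / c b q)"
    have v: "(\<Sum>p\<in>A. c e p * v p)
        = (\<Sum>p\<in>A'. c e p * u p) - c e q * (\<Sum>p\<in>A'. c b p * u p) / c b q" for e
    proof -
      have "(\<Sum>p\<in>A'. c e p * v p) = (\<Sum>p\<in>A'. c e p * u p)"
        using A'(2) by (intro sum.cong) (auto simp: v_def)
      then show ?thesis using A' by (simp add: v_def)
    qed
    have "(\<Sum>p\<in>A. c e p * v p) = 0" if "e \<in> insert b B" for e
    proof (cases "e = b")
      case True
      then show ?thesis using q by (simp add: v)
    next
      case False
      then have "(\<Sum>p\<in>A'. (c e p - c e q * c b p / c b q) * u p) = 0" using u that by simp
      then show ?thesis
        unfolding v
        by (simp add: left_diff_distrib sum_subtractf sum_distrib_left sum_divide_distrib mult.assoc)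
    qed
    moreover have "\<exists>p\<in>A. v p \<noteq> 0" using u(1) A' by (auto simp: v_def)
    ultimately show ?thesis by blast
  qed
qed

text \<open>
  The two pure powers among the generators make the set of monomials outside \<open>\<mm>I\<close> finite, so that
  unknowns and equations can be counted.
\<close>
lemma full_imp_small_generator:
  fixes G :: "(nat \<times> nat) set" and a :: "'k::field poly poly"
  assumes fin: "finite G" and s: "(s, 0) \<in> G" and t: "(0, t) \<in> G"
    and a: "a \<in> ideal_xy"
    and full: "ideal_colon Kxy (ideal_xy \<cdot>\<^bsub>Kxy\<^esub> mono_ideal (upset G)) a \<subseteq> mono_ideal (upset G)"
  shows "\<exists>(i, j)\<in>G. i + j < card G"
proof (rule ccontr)
  assume "\<not> ?thesis"
  then have deg: "card G \<le> i + j" if "(i, j) \<in> G" for i j using that by force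
  define n where "n = card G"
  define T where "T = exp_sum (upset max_exps) (upset G)"
  have prod: "ideal_xy \<cdot>\<^bsub>Kxy\<^esub> mono_ideal (upset G) = (mono_ideal T :: 'k poly poly set)"
    by (simp add: ideal_xy_mono_ideal ideal_prod_mono_ideal T_def)
  have T_deg: "n < i + j" if ij: "(i, j) \<in> T" for i j
  proof -
    obtain k l where kl: "(k, l) \<in> G" "k \<le> i" "l \<le> j" "(k, l) \<noteq> (i, j)"
      using ij by (auto simp: T_def exp_sum_max_iff)
    have "k + l < i + j" using kl by auto
    then show ?thesis using deg[OF kl(1)] by (simp add: n_def)
  qed
  have out_box: "- T \<subseteq> {..s} \<times> {..t}"
  proof
    fix p assume p: "p \<in> - T"
    obtain i j where ij: "p = (i, j)" by (cases p)
    have "\<not> s < i" "\<not> t < j"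
      using p s t unfolding ij T_def Compl_iff exp_sum_max_iff by fastforce+
    then show "p \<in> {..s} \<times> {..t}" by (simp add: ij)
  qed
  then have finT: "finite (- T)" by (rule finite_subset) simp
  \<comment> \<open>\<open>A\<close> indexes the unknowns and \<open>B\<close> the equations; \<open>D\<close> is the antidiagonal of degree \<open>n\<close>.\<close>
  define A where "A = {(i, j). (i, j) \<notin> T \<and> (i, j) \<notin> G \<and> n \<le> i + j}"
  define B where "B = {(i, j). (i, j) \<notin> T \<and> n < i + j}"
  define D where "D = (\<lambda>i. (i, n - i)) ` {..n}"
  have finA: "finite A" by (rule finite_subset[OF _ finT]) (auto simp: A_def)
  have finB: "finite B" by (rule finite_subset[OF _ finT]) (auto simp: B_def)
  have cardD: "card D = n + 1"
    by (simp add: D_def card_image inj_on_def)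
  have "B \<inter> D = {}" by (auto simp: B_def D_def)
  then have "card B + card D = card (B \<union> D)"
    using finB by (simp add: card_Un_disjoint D_def)
  also have "B \<union> D \<subseteq> A \<union> G"
    using T_deg by (force simp: A_def B_def D_def)
  then have "card (B \<union> D) \<le> card (A \<union> G)"
    using finA fin by (intro card_mono) auto
  also have "\<dots> \<le> card A + card G" by (rule card_Un_le)
  finally have "card B < card A" using cardD by (simp add: n_def)
  from homogeneous_system_nontrivial[OF finB finA this,
      of "\<lambda>p q. cf (a * cmonom 1 (fst q) (snd q)) (fst p) (snd p)"]
  obtain u p where p: "p \<in> A" "u p \<noteq> 0" and u:
    "\<And>i j. (i, j) \<in> B \<Longrightarrow> (\<Sum>q\<in>A. cf (a * cmonom 1 (fst q) (snd q)) i j * u q) = 0"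
    by fastforce
  define f where "f = (\<Sum>q\<in>A. cmonom (u q) (fst q) (snd q))"
  have cmonom_scale: "cf (a * cmonom (u q) (fst q) (snd q)) i j
      = cf (a * cmonom 1 (fst q) (snd q)) i j * u q" for q i j
    by (simp add: mult.commute[of a] cf_cmonom_mult)
  have "a * f \<in> mono_ideal T"
  proof -
    have "cf (a * f) i j = 0" if ij: "(i, j) \<notin> T" for i j
    proof -
      have eq: "cf (a * f) i j = (\<Sum>q\<in>A. cf (a * cmonom 1 (fst q) (snd q)) i j * u q)"
        by (simp add: f_def sum_distrib_left cf_sum cmonom_scale)
      show ?thesis
      proof (cases "n < i + j")
        case True
        then show ?thesis using eq u ij by (simp add: B_def)
      next
        case False
        \<comment> \<open>No equation is needed here: \<open>a\<close> has no constant term, so \<open>a * f\<close> has no terms of degree at most \<open>n\<close>.\<close>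
        have "cf a 0 0 = 0"
          using a by (intro mono_idealD[of a]) (auto simp: ideal_xy_mono_ideal upset_max_exps)
        then have "cf (a * cmonom 1 k l) i j = 0" if "(k, l) \<in> A" for k l
          using that False by (auto simp: A_def mult.commute[of a] cf_cmonom_mult)
        then show ?thesis unfolding eq by (intro sum.neutral) auto
      qed
    qed
    then show ?thesis by (auto simp: mono_ideal_def)
  qed
  then have "f \<in> ideal_colon Kxy (ideal_xy \<cdot>\<^bsub>Kxy\<^esub> mono_ideal (upset G)) a"
    by (simp add: ideal_colon_def prod mult.commute)
  then have "f \<in> mono_ideal (upset G)" using full by auto
  moreover have "cf f (fst p) (snd p) = u p"
  proof -
    have "cf f (fst p) (snd p) = (\<Sum>q\<in>A. if q = p then u q else 0)"
      unfolding f_def cf_sum by (intro sum.cong) (auto simp: cf_cmonom prod_eq_iff)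
    then show ?thesis using p(1) finA by simp
  qed
  ultimately have "p \<in> upset G" using p(2) by (cases p) (auto simp: mono_ideal_def)
  moreover have "p \<notin> T" "p \<notin> G" using p(1) by (auto simp: A_def)
  moreover have "upset G \<subseteq> T \<union> G"
    unfolding T_def by (auto simp: exp_sum_max_iff) (auto simp: upset_def)
  ultimately show False by blast
qed

section \<open>Multiplication by x + y\<close>

text \<open>
  The relation determines row \<open>j\<close> from row \<open>j - 1\<close> one column further right.  Since \<open>h\<close> drops by at
  least one in each row, the shifted point is still below the staircase, and the recursion ends
  in row 0, where the second term is absent.
\<close>
lemma staircase_vanishing:
  fixes F :: "nat \<Rightarrow> nat \<Rightarrow> 'k::field" and h :: "nat \<Rightarrow> nat"
  assumes dec: "\<And>j. Suc j < m \<Longrightarrow> h (Suc j) < h j"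
    and out: "\<And>i j. j < m \<Longrightarrow> i < h j \<Longrightarrow> F i j + (if j = 0 then 0 else F (Suc i) (j - 1)) = 0"
    and "j < m" "i < h j"
  shows "F i j = 0"
  using assms(3,4)
proof (induction j arbitrary: i)
  case 0
  then show ?case using out[of 0 i] by simp
next
  case (Suc j)
  have "F (Suc i) j = 0" using Suc dec[of j] by (intro Suc.IH) auto
  then show ?case using out[of "Suc j" i] Suc.prems by simp
qed

lemma cf_mult_x_plus_y:
  "cf (f * (var_x + var_y)) i j
    = (if i = 0 then 0 else cf f (i - 1) j) + (if j = 0 then 0 else cf f i (j - 1))"
  by (simp add: distrib_left mult.commute[of f] var_x_cmonom var_y_cmonom cf_cmonom_mult)

lemma x_plus_y_notin_square: "var_x + var_y \<in> ideal_xy - ideal_xy \<cdot>\<^bsub>Kxy\<^esub> ideal_xy"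
proof -
  have "(1, 0) \<notin> exp_sum (upset max_exps) (upset max_exps)"
    unfolding exp_sum_max_iff by (auto simp: max_exps_def)
  moreover have "cf (var_x + var_y) 1 0 = 1"
    by (simp add: var_x_cmonom var_y_cmonom cf_cmonom)
  ultimately have "var_x + var_y \<notin> ideal_xy \<cdot>\<^bsub>Kxy\<^esub> ideal_xy"
    unfolding ideal_xy_mono_ideal ideal_prod_mono_ideal
    by (metis mono_idealD zero_neq_one)
  moreover have "var_x + var_y \<in> ideal_xy"
    by (auto simp: ideal_xy_mono_ideal mono_ideal_def var_x_cmonom var_y_cmonom cf_cmonom
        upset_max_exps)
  ultimately show ?thesis by simp
qed

text \<open>
  With the corner \<open>(n - k, k - 1)\<close> every row below \<open>k\<close> and every column up to \<open>n - k\<close> contains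
  exactly one generator, and a monomial outside \<open>L\<close> lies in such a row or column.  Passing the end
  of a row by one point leads at most to the generator, which is not in \<open>\<mm>L\<close>, so there the
  coefficient of \<open>f * (x + y)\<close> has to vanish.  The same holds for columns, and
  \<open>staircase_vanishing\<close> applies to both.
\<close>
lemma colon_x_plus_y:
  fixes a c :: "nat \<Rightarrow> nat" and n :: nat
  defines "L \<equiv> (mono_ideal (upset {(a i, c i) | i. 1 \<le> i \<and> i \<le> n}) :: 'k::field poly poly set)"
  assumes dec: "\<And>i j. 1 \<le> i \<Longrightarrow> i < j \<Longrightarrow> j \<le> n \<Longrightarrow> a j < a i"
    and inc: "\<And>i j. 1 \<le> i \<Longrightarrow> i < j \<Longrightarrow> j \<le> n \<Longrightarrow> c i < c j"
    and k: "1 \<le> k" "k \<le> n"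
    and c: "\<And>i. 1 \<le> i \<Longrightarrow> i \<le> k \<Longrightarrow> c i = i - 1"
    and a: "\<And>i. k \<le> i \<Longrightarrow> i \<le> n \<Longrightarrow> a i = n - i"
  shows "ideal_colon Kxy (ideal_xy \<cdot>\<^bsub>Kxy\<^esub> L) (var_x + var_y) = L"
proof
  define G where "G = {(a i, c i) | i. 1 \<le> i \<and> i \<le> n}"
  define T where "T = exp_sum (upset max_exps) (upset G)"
  have prod: "ideal_xy \<cdot>\<^bsub>Kxy\<^esub> L = mono_ideal T"
    by (simp add: L_def ideal_xy_mono_ideal ideal_prod_mono_ideal T_def G_def)
  show "L \<subseteq> ideal_colon Kxy (ideal_xy \<cdot>\<^bsub>Kxy\<^esub> L) (var_x + var_y)"
    using x_plus_y_notin_square ideal_prod.prod[of "var_x + var_y" ideal_xy _ L Kxy]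
    by (auto simp: ideal_colon_def mult.commute)
  show "ideal_colon Kxy (ideal_xy \<cdot>\<^bsub>Kxy\<^esub> L) (var_x + var_y) \<subseteq> L"
  proof
    fix f assume "f \<in> ideal_colon Kxy (ideal_xy \<cdot>\<^bsub>Kxy\<^esub> L) (var_x + var_y)"
    then have f: "f * (var_x + var_y) \<in> mono_ideal T"
      by (simp add: ideal_colon_def prod)
    have eq: "(if i = 0 then 0 else cf f (i - 1) j) + (if j = 0 then 0 else cf f i (j - 1)) = 0"
      if "(i, j) \<notin> T" for i j
      using mono_idealD[OF f that] by (simp only: cf_mult_x_plus_y)
    \<comment> \<open>The generator in row \<open>j\<close> has index \<open>Suc j\<close>, the one in column \<open>i\<close> has index \<open>n - i\<close>.\<close>
    have rows: "cf f i j = 0" if "j < k" "i < a (Suc j)" for i j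
    proof (rule staircase_vanishing[where m = k and h = "\<lambda>j. a (Suc j)" and F = "cf f"])
      fix i j assume ij: "j < k" "i < a (Suc j)"
      have "(Suc i, j) \<notin> T"
      proof
        assume "(Suc i, j) \<in> T"
        then obtain l where l: "1 \<le> l" "l \<le> n" "a l \<le> Suc i" "c l \<le> j" "(a l, c l) \<noteq> (Suc i, j)"
          unfolding T_def exp_sum_max_iff G_def by auto
        have "\<not> Suc j < l" using inc[of "Suc j" l] c[of "Suc j"] ij l by auto
        moreover have "\<not> l < Suc j" using dec[of l "Suc j"] ij l k by auto
        ultimately have "l = Suc j" by simp
        then show False using l ij c[of "Suc j"] by auto
      qed
      from eq[OF this] show "cf f i j + (if j = 0 then 0 else cf f (Suc i) (j - 1)) = 0" by simp
    qed (use that dec k in auto)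
    have columns: "cf f i j = 0" if "i < Suc n - k" "j < c (n - i)" for i j
    proof (rule staircase_vanishing[where m = "Suc n - k" and h = "\<lambda>i. c (n - i)"
            and F = "\<lambda>j i. cf f i j"])
      fix j i assume ij: "i < Suc n - k" "j < c (n - i)"
      have "(i, Suc j) \<notin> T"
      proof
        assume "(i, Suc j) \<in> T"
        then obtain l where l: "1 \<le> l" "l \<le> n" "a l \<le> i" "c l \<le> Suc j" "(a l, c l) \<noteq> (i, Suc j)"
          unfolding T_def exp_sum_max_iff G_def by auto
        have ai: "a (n - i) = i" using a[of "n - i"] ij by simp
        have pos: "1 \<le> n - i" using ij(1) k(1) by linarith
        have "\<not> l < n - i" using dec[of l "n - i"] ai ij l by auto
        moreover have "\<not> n - i < l" using inc[of "n - i" l] pos ij(2) l(2,4) by linarith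
        ultimately have "l = n - i" by simp
        then show False using l ij ai by auto
      qed
      from eq[OF this] show "cf f i j + (if i = 0 then 0 else cf f (i - 1) (Suc j)) = 0"
        by (simp add: add.commute)
    qed (use that k in \<open>auto intro!: inc\<close>)
    have "cf f i j = 0" if out: "(i, j) \<notin> upset G" for i j
    proof -
      have G: "\<not> (a l \<le> i \<and> c l \<le> j)" if "1 \<le> l" "l \<le> n" for l
        using out that unfolding upset_def G_def by blast
      consider "j < k" | "k \<le> j" "i < Suc n - k" | "k \<le> j" "Suc n - k \<le> i" by linarith
      then show ?thesis
      proof cases
        case 1
        then show ?thesis using G[of "Suc j"] c[of "Suc j"] k by (intro rows) auto
      next
        case 2
        then have "1 \<le> n - i" "k \<le> n - i" using k by linarith+
        then show ?thesis using 2 G[of "n - i"] a[of "n - i"] by (intro columns) auto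
      next
        case 3
        then show ?thesis using G[of k] a[of k] c[of k] k by auto
      qed
    qed
    moreover have "L = mono_ideal (upset G)" by (simp only: L_def G_def)
    ultimately show "f \<in> L" by (auto simp: mono_ideal_def)
  qed
qed

section \<open>Staircases with a corner of least degree\<close>

text \<open>
  The clause in the middle makes \<open>k\<close> unique: \<open>c\<close> has unit steps exactly up to \<open>k\<close>.
\<close>
definition unit_steps :: "nat \<Rightarrow> (nat \<Rightarrow> nat) \<Rightarrow> (nat \<Rightarrow> nat) \<Rightarrow> nat \<Rightarrow> bool" where
  "unit_steps n a c k \<longleftrightarrow> 1 \<le> k \<and> k \<le> n \<and> (\<forall>i. 1 \<le> i \<and> i < k \<longrightarrow> c (i + 1) = c i + 1) \<and>
     (k = n \<or> k < n \<and> c k + 2 \<le> c (k + 1)) \<and> (\<forall>i. k \<le> i \<and> i < n \<longrightarrow> a i = a (i + 1) + 1)"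

lemma unit_steps_ascending:
  assumes "unit_steps n a c k" "c 1 = 0" "1 \<le> i" "i \<le> k"
  shows "c i = i - 1"
  using assms(3,4)
proof (induction i rule: dec_induct)
  case (step i)
  then show ?case using assms(1) by (auto simp: unit_steps_def)
qed (use assms(2) in simp)

lemma unit_steps_descending:
  assumes "unit_steps n a c k" "a n = 0" "k \<le> i" "i \<le> n"
  shows "a i = n - i"
  using assms(4,3)
proof (induction i rule: inc_induct)
  case (step i)
  then show ?case using assms(1) by (auto simp: unit_steps_def)
qed (simp add: assms(2))

text \<open>
  By strict monotonicity \<open>a i \<ge> n - i\<close> and \<open>c i \<ge> i - 1\<close>, so a point of degree less than \<open>n\<close> attains
  both bounds, which leaves no room for steps other than 1 on the segments where a bound is attained.
  The index of the small point itself need not be \<open>k\<close>: the required \<open>k\<close> is the last index at which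
  \<open>c\<close> attains its bound.
\<close>
lemma small_generator_iff_unit_steps:
  fixes a c :: "nat \<Rightarrow> nat"
  assumes dec: "\<And>i. 1 \<le> i \<Longrightarrow> i < n \<Longrightarrow> a (i + 1) < a i" and a0: "a n = 0"
    and inc: "\<And>i. 1 \<le> i \<Longrightarrow> i < n \<Longrightarrow> c i < c (i + 1)" and c0: "c 1 = 0"
  shows "(\<exists>i. 1 \<le> i \<and> i \<le> n \<and> a i + c i < n) \<longleftrightarrow> (\<exists>k. unit_steps n a c k)"
    (is "?small \<longleftrightarrow> _")
proof -
  have a_gap: "a j + j \<le> a i + i" if "1 \<le> i" "i \<le> j" "j \<le> n" for i j
    using that(2,3)
  proof (induction j rule: dec_induct)
    case (step j)
    then show ?case using dec[of j] that(1) by auto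
  qed simp
  have c_gap: "c i + j \<le> c j + i" if "1 \<le> i" "i \<le> j" "j \<le> n" for i j
    using that(2,3)
  proof (induction j rule: dec_induct)
    case (step j)
    then show ?case using inc[of j] that(1) by auto
  qed simp
  show ?thesis
  proof
    assume "\<exists>k. unit_steps n a c k"
    then obtain k where k: "unit_steps n a c k" ..
    then have "1 \<le> k" "k \<le> n" by (simp_all add: unit_steps_def)
    then show ?small
      using unit_steps_ascending[OF k c0, of k] unit_steps_descending[OF k a0, of k]
      by (intro exI[of _ k]) auto
  next
    assume ?small
    then obtain m where m: "1 \<le> m" "m \<le> n" "a m + c m < n" by blast
    define S where "S = {k. 1 \<le> k \<and> k \<le> n \<and> c k < k}"
    have fin: "finite S" by (rule finite_subset[of _ "{..n}"]) (auto simp: S_def)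
    have mS: "m \<in> S" using m a_gap[of m n] a0 by (simp add: S_def)
    define k where "k = Max S"
    have "k \<in> S" unfolding k_def using fin mS by (intro Max_in) auto
    then have k: "1 \<le> k" "k \<le> n" "c k < k" by (auto simp: S_def)
    have mk: "m \<le> k" unfolding k_def using fin mS by (rule Max_ge)
    have "c (i + 1) = c i + 1" if i: "1 \<le> i" "i < k" for i
      using c_gap[of 1 i] c_gap[of "i + 1" k] inc[of i] c0 i k by simp
    moreover have "c k + 2 \<le> c (k + 1)" if "k < n"
    proof -
      have "k + 1 \<notin> S" using Max_ge[OF fin, of "k + 1"] by (auto simp: k_def)
      then show ?thesis using that k by (simp add: S_def)
    qed
    moreover have "a i = a (i + 1) + 1" if i: "k \<le> i" "i < n" for i
      using a_gap[of m i] a_gap[of "i + 1" n] c_gap[of 1 m] dec[of i] a0 c0 i k m mk by simp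
    ultimately show "\<exists>k. unit_steps n a c k"
      using k by (intro exI[of _ k]) (auto simp: unit_steps_def)
  qed
qed

theorem theorem2p9:
  fixes a b :: "nat \<Rightarrow> nat" and n :: nat and I :: "'k::field poly poly set"
  assumes "n \<ge> 2"
    and "\<And>i. 1 \<le> i \<Longrightarrow> i < n \<Longrightarrow> a i > a (i + 1)" and "a n = 0"
    and "\<And>i. 1 \<le> i \<Longrightarrow> i < n \<Longrightarrow> b i > b (i + 1)" and "b n = 0"
    and "I = Idl\<^bsub>Kxy\<^esub> {var_x ^ a i * var_y ^ b (n - i + 1) | i. 1 \<le> i \<and> i \<le> n}"
  shows "m_full Kxy ideal_xy I \<longleftrightarrow>
    (\<exists>k. 1 \<le> k \<and> k \<le> n \<and>
      (\<forall>i. 1 \<le> i \<and> i \<le> k - 1 \<longrightarrow> int (b (n - i)) - int (b (n - i + 1)) = 1) \<and>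
      (k = n \<or> k < n \<and> int (b (n - k)) - int (b (n - k + 1)) \<ge> 2) \<and>
      (\<forall>i. k \<le> i \<and> i \<le> n - 1 \<longrightarrow> int (a i) - int (a (i + 1)) = 1))"
proof -
  define c where "c = (\<lambda>i. b (n - i + 1))"
  define G where "G = {(a i, c i) | i. 1 \<le> i \<and> i \<le> n}"
  note dec = assms(2) and a0 = assms(3)
  have c_Suc: "c (i + 1) = b (n - i)" if "i < n" for i
    using that by (simp add: c_def Suc_diff_Suc)
  have inc: "c i < c (i + 1)" if "1 \<le> i" "i < n" for i
    using assms(4)[of "n - i"] that by (simp only: c_Suc) (simp add: c_def)
  have c0: "c 1 = 0" using assms(1,5) by (simp add: c_def)
  have a_less: "a j < a i" if "1 \<le> i" "i < j" "j \<le> n" for i j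
    using Suc_leI[OF that(2)] that(3)
  proof (induction j rule: dec_induct)
    case (step j)
    then show ?case using dec[of j] that(1) by simp
  qed (use dec that(1) in simp)
  have c_less: "c i < c j" if "1 \<le> i" "i < j" "j \<le> n" for i j
    using Suc_leI[OF that(2)] that(3)
  proof (induction j rule: dec_induct)
    case (step j)
    then show ?case using inc[of j] that(1) by simp
  qed (use inc that(1) in simp)
  have I: "I = mono_ideal (upset G)"
  proof -
    have "{var_x ^ a i * var_y ^ b (n - i + 1) | i. 1 \<le> i \<and> i \<le> n}
        = {var_x ^ p * var_y ^ q :: 'k poly poly | p q. (p, q) \<in> G}"
      by (auto simp: G_def c_def)
    then show ?thesis by (simp only: assms(6) genideal_monomials)
  qed
  have G_image: "G = (\<lambda>i. (a i, c i)) ` {1..n}" by (auto simp: G_def)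
  have finG: "finite G" and cardG: "card G \<le> n"
    unfolding G_image using card_image_le[of "{1..n}"] by auto
  have corners: "(a 1, 0) \<in> G" "(0, c n) \<in> G"
    using assms(1) c0 a0 by (auto simp: G_def intro: exI[of _ 1] exI[of _ n])
  have origin: "(0, 0) \<notin> G"
  proof
    assume "(0, 0) \<in> G"
    then obtain i where i: "1 \<le> i" "i \<le> n" "a i = 0" "c i = 0" by (auto simp: G_def)
    then show False using a_less[of i n] c_less[of 1 i] assms(1) by (cases "i = n") auto
  qed
  have "m_full Kxy ideal_xy I \<longleftrightarrow> (\<exists>k. unit_steps n a c k)"
  proof
    assume "m_full Kxy ideal_xy I"
    then obtain f where "f \<in> ideal_xy" "ideal_colon Kxy (ideal_xy \<cdot>\<^bsub>Kxy\<^esub> I) f \<subseteq> I"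
      unfolding m_full_def by auto
    then have "\<exists>(i, j)\<in>G. i + j < card G"
      using full_imp_small_generator[OF finG corners] unfolding I by blast
    then have "\<exists>i. 1 \<le> i \<and> i \<le> n \<and> a i + c i < n"
      using cardG by (fastforce simp: G_def)
    then show "\<exists>k. unit_steps n a c k" 
      using small_generator_iff_unit_steps[of n a c, OF dec a0 inc c0] by simp
  next
    assume "\<exists>k. unit_steps n a c k"
    then obtain k where k: "unit_steps n a c k" ..
    then have "1 \<le> k" "k \<le> n" by (simp_all add: unit_steps_def)
    then have "ideal_colon Kxy (ideal_xy \<cdot>\<^bsub>Kxy\<^esub> I) (var_x + var_y) = I"
      unfolding I G_def
      by (intro colon_x_plus_y[where k = k] a_less c_less
          unit_steps_ascending[OF k c0] unit_steps_descending[OF k a0])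
    then show "m_full Kxy ideal_xy I"
      unfolding m_full_def I
      by (intro conjI bexI[OF _ x_plus_y_notin_square] mono_ideal_primary[OF corners origin])
  qed
  also have "(\<lambda>k. unit_steps n a c k) = (\<lambda>k. 1 \<le> k \<and> k \<le> n \<and>
      (\<forall>i. 1 \<le> i \<and> i \<le> k - 1 \<longrightarrow> int (b (n - i)) - int (b (n - i + 1)) = 1) \<and>
      (k = n \<or> k < n \<and> int (b (n - k)) - int (b (n - k + 1)) \<ge> 2) \<and>
      (\<forall>i. k \<le> i \<and> i \<le> n - 1 \<longrightarrow> int (a i) - int (a (i + 1)) = 1))"
    unfolding unit_steps_def
  proof (intro ext conj_cong refl)
    fix k assume k: "1 \<le> k" "k \<le> n"
    have "c (i + 1) = c i + 1 \<longleftrightarrow> int (b (n - i)) - int (b (n - i + 1)) = 1" if "i < k" for i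
    proof -
      have "c (i + 1) = b (n - i)" "c i = b (n - i + 1)" using c_Suc that k by (auto simp: c_def)
      then show ?thesis by auto
    qed
    moreover have "i < k \<longleftrightarrow> i \<le> k - 1" for i using k by auto
    ultimately show "(\<forall>i. 1 \<le> i \<and> i < k \<longrightarrow> c (i + 1) = c i + 1) \<longleftrightarrow>
        (\<forall>i. 1 \<le> i \<and> i \<le> k - 1 \<longrightarrow> int (b (n - i)) - int (b (n - i + 1)) = 1)"
      by (simp cong: conj_cong)
    have "c k + 2 \<le> c (k + 1) \<longleftrightarrow> int (b (n - k)) - int (b (n - k + 1)) \<ge> 2" if "k < n"
    proof -
      have "c (k + 1) = b (n - k)" "c k = b (n - k + 1)" using c_Suc that by (auto simp: c_def)
      then show ?thesis by auto
    qed
    then show "(k = n \<or> k < n \<and> c k + 2 \<le> c (k + 1)) \<longleftrightarrow>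
        (k = n \<or> k < n \<and> int (b (n - k)) - int (b (n - k + 1)) \<ge> 2)" by blast
    have "a i = a (i + 1) + 1 \<longleftrightarrow> int (a i) - int (a (i + 1)) = 1" for i by auto
    moreover have "i < n \<longleftrightarrow> i \<le> n - 1" for i using assms(1) by auto
    ultimately show "(\<forall>i. k \<le> i \<and> i < n \<longrightarrow> a i = a (i + 1) + 1) \<longleftrightarrow>
        (\<forall>i. k \<le> i \<and> i \<le> n - 1 \<longrightarrow> int (a i) - int (a (i + 1)) = 1)"
      by (simp cong: conj_cong)
  qed
  finally show ?thesis .
qed

end
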